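(* Define the linear map $T : \ell_1 \to \ell_\infty$ by $$(Tx^* )_j := \tau_j + \tau_{j+1} \quad (j \ge 1), \qquad \text{where } \tau_j := \sum_{i=j}^\infty x_i^*,$$ so that $R(T) \subset \widehat{c_0}$. Define $S : c_0 \rightrightarrows \ell_1$ by $x^* \in Sx \iff \widehat{x} = Tx^*$. Then $S$ is maximally monotone and quasidense, and $S^{\mathbb F} = T$ is maximally monotone but not quasidense.
   Context: Let $E := c_0$ (real null sequences, sup norm), $E^* = \ell_1$, $E^{**} = \ell_\infty$ with the usual pairings; $\widehat{x}$ is the canonical image of $x \in c_0$ in $\ell_\infty$, $\widehat{c_0} := \{\widehat{x} : x \in c_0\}$, and $R(T)$ is the range of $T$. For a nonzero real Banach space $F$ and a multifunction $U : F \rightrightarrows F^*$, $G(U) := \{(x,x^* ) : x^* \in Ux\}$ is its graph; $U$ is maximally monotone if $G(U)$ is a maximally monotone subset of $F \times F^*$, and quasidense if, for all $(x,x^* ) \in F \times F^*$, $\inf_{(s,s^* ) \in G(U)}\big[\frac12\|s-x\|^2 + \frac12\|s^*-x^*\|^2 + \langle s-x, s^*-x^*\rangle\big] \le 0$. These notions are used with $F = c_0$ for $S$ and with $F = \ell_1$, $F^* = \ell_\infty$ for $T$. For a closed (i.e. with norm-closed graph), quasidense, monotone $S : E \rightrightarrows E^*$, let $\varphi_S(x,x^* ) := \sup_{(s,s^* ) \in G(S)}[\langle s, x^*\rangle + \langle x, s^*\rangle - \langle s, s^*\rangle]$ and ${\varphi_S}^*(y^*,y^{**}) := \sup_{(x,x^*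 ) \in E \times E^*}[\langle x, y^*\rangle + \langle x^*, y^{**}\rangle - \varphi_S(x,x^* )]$; the Fitzpatrick extension $S^{\mathbb F} : E^* \rightrightarrows E^{**}$ is the multifunction with graph $G(S^{\mathbb F}) := \{(y^*,y^{**}) \in E^* \times E^{**} : {\varphi_S}^*(y^*,y^{**}) = \langle y^*, y^{**}\rangle\}$. *)

theory Defs
  imports "HOL-Analysis.Analysis"
begin

section \<open>The sequence spaces\<close>

text \<open>Sequences are indexed from 0, so the index \<open>j \<ge> 1\<close> of the usual notation becomes \<open>j - 1\<close>.
  Every function on the discrete space \<^typ>\<open>nat\<close> is continuous, so the type of bounded
  continuous functions on it, with its supremum norm, is the space of all bounded sequences.\<close>

type_synonym linf = "nat \<Rightarrow>\<^sub>C real"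

lemma bcontfun_nat_iff: "f \<in> bcontfun \<longleftrightarrow> bounded (range f)" for f :: "nat \<Rightarrow> real"
  by (simp add: bcontfun_def)

text \<open>The library declares this instance only for metric domains, and \<^typ>\<open>nat\<close> is not an
  instance of \<^class>\<open>metric_space\<close>.\<close>

instance bcontfun :: (topological_space, complete_space) complete_space
proof
  fix f :: "nat \<Rightarrow> ('a, 'b) bcontfun"
  assume f: "Cauchy f"
  have "\<exists>N. \<forall>n\<ge>N. \<forall>m\<ge>N. \<forall>x. True \<longrightarrow> dist (f m x) (f n x) < e" if "e > 0" for e
    using f that dist_fun_lt_imp_dist_val_lt unfolding Cauchy_def by metis
  then obtain g where "\<forall>e>0. \<exists>N. \<forall>n\<ge>N. \<forall>x. True \<longrightarrow> dist (f n x) (g x) < e"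
    using uniformly_convergent_eq_cauchy[of "\<lambda>_. True" "\<lambda>n. apply_bcontfun (f n)"] by metis
  then have "uniform_limit UNIV f g sequentially"
    by (simp add: uniform_limit_sequentially_iff)
  from uniform_limit_bcontfunE[OF this sequentially_bot]
  obtain l where "g = apply_bcontfun l" "f \<longlonglongrightarrow> l" by metis
  then show "convergent f"
    by (intro convergentI)
qed

instance bcontfun :: (topological_space, banach) banach ..

subsection \<open>Null sequences\<close>

text \<open>The representation morphism \<open>hat\<close> is the canonical embedding into the bidual:
  it satisfies \<open>l1_pair y (hat x) = c0_pair x y\<close> for the pairings defined below.\<close>

typedef c0 = "{f :: linf. apply_bcontfun f \<longlonglongrightarrow> 0}"
  morphisms hat Abs_c0
  by (rule exI[of _ 0]) simp

setup_lifting type_definition_c0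

instantiation c0 :: real_vector
begin

lift_definition zero_c0 :: c0 is 0 by simp
lift_definition plus_c0 :: "c0 \<Rightarrow> c0 \<Rightarrow> c0" is "(+)"
  by (auto intro: tendsto_add_zero)
lift_definition minus_c0 :: "c0 \<Rightarrow> c0 \<Rightarrow> c0" is "(-)"
  using tendsto_diff[of _ 0 sequentially _ 0] by auto
lift_definition uminus_c0 :: "c0 \<Rightarrow> c0" is uminus
  using tendsto_minus[of _ 0 sequentially] by auto
lift_definition scaleR_c0 :: "real \<Rightarrow> c0 \<Rightarrow> c0" is "(*\<^sub>R)"
  by (auto intro: tendsto_mult_right_zero)

instance
proof
  fix x y z :: c0 and a b :: real
  show "x + y + z = x + (y + z)" "x + y = y + x" "0 + x = x" "- x + x = 0" "x - y = x + - y"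
    by (transfer; simp)+
  show "a *\<^sub>R (x + y) = a *\<^sub>R x + a *\<^sub>R y" "(a + b) *\<^sub>R x = a *\<^sub>R x + b *\<^sub>R x"
    "a *\<^sub>R b *\<^sub>R x = (a * b) *\<^sub>R x" "1 *\<^sub>R x = x"
    by (transfer; simp add: algebra_simps)+
qed

end

instantiation c0 :: real_normed_vector
begin

lift_definition norm_c0 :: "c0 \<Rightarrow> real" is norm .
definition dist_c0 :: "c0 \<Rightarrow> c0 \<Rightarrow> real" where "dist_c0 x y = norm (x - y)"
definition sgn_c0 :: "c0 \<Rightarrow> c0" where "sgn_c0 x = x /\<^sub>R norm x"
definition uniformity_c0 :: "(c0 \<times> c0) filter"
  where "uniformity_c0 = (INF e\<in>{0 <..}. principal {(x, y). dist x y < e})"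
definition open_c0 :: "c0 set \<Rightarrow> bool"
  where "open_c0 U = (\<forall>x\<in>U. \<forall>\<^sub>F (x', y) in uniformity. x' = x \<longrightarrow> y \<in> U)"

instance
proof
  fix x y :: c0 and a :: real
  show "(norm x = 0) = (x = 0)" "norm (a *\<^sub>R x) = \<bar>a\<bar> * norm x"
    by (transfer; simp)+
  show "norm (x + y) \<le> norm x + norm y"
    by transfer (rule norm_triangle_ineq)
qed (rule dist_c0_def sgn_c0_def uniformity_c0_def open_c0_def)+

end

lemma hat_simps [simp]:
  "hat 0 = 0" "hat (x + y) = hat x + hat y" "hat (x - y) = hat x - hat y"
  "hat (- x) = - hat x" "hat (a *\<^sub>R x) = a *\<^sub>R hat x"
  by (transfer; simp)+

lemma norm_hat [simp]: "norm (hat x) = norm x"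
  by transfer simp

lemma hat_tendsto: "apply_bcontfun (hat x) \<longlonglongrightarrow> 0"
  using hat[of x] by simp

lemma abs_hat_le: "\<bar>hat x n\<bar> \<le> norm x"
  using norm_bounded[of "hat x" n] by simp

lemma bounded_linear_hat: "bounded_linear hat"
  by (rule bounded_linear_intro[where K = 1]) auto

lemma Bcontfun_inverse_nat:
  "bounded (range f) \<Longrightarrow> apply_bcontfun (Bcontfun f) = f" for f :: "nat \<Rightarrow> real"
  by (simp add: Bcontfun_inverse bcontfun_nat_iff)

lemma null_seq_cases:
  fixes f :: "nat \<Rightarrow> real"
  assumes "f \<longlonglongrightarrow> 0"
  obtains x where "apply_bcontfun (hat x) = f"
proof
  have "bounded (range f)" using assms by (rule convergent_imp_bounded)
  then show "apply_bcontfun (hat (Abs_c0 (Bcontfun f))) = f"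
    using assms by (simp add: Abs_c0_inverse Bcontfun_inverse_nat)
qed

lemma c0_eqI: "(\<And>n. hat x n = hat y n) \<Longrightarrow> x = y"
  by (simp add: bcontfun_eqI hat_inject[symmetric])

lemma hat_LIMSEQ_iff: "(\<lambda>n. hat (X n)) \<longlonglongrightarrow> hat x \<longleftrightarrow> X \<longlonglongrightarrow> x"
  by (simp add: LIMSEQ_iff hat_simps(3)[symmetric] del: hat_simps)

instance c0 :: banach
proof
  fix X :: "nat \<Rightarrow> c0"
  assume "Cauchy X"
  then have "Cauchy (\<lambda>n. hat (X n))"
    by (rule bounded_linear.Cauchy[OF bounded_linear_hat])
  then have "convergent (\<lambda>n. hat (X n))" by (rule Cauchy_convergent)
  then obtain f where f: "(\<lambda>n. hat (X n)) \<longlonglongrightarrow> f"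
    unfolding convergent_def by (rule exE)
  have "apply_bcontfun f \<longlonglongrightarrow> 0"
  proof (rule swap_uniform_limit'[where F = sequentially and g = "\<lambda>_. 0"])
    show "\<forall>\<^sub>F n in sequentially. apply_bcontfun (hat (X n)) \<longlonglongrightarrow> 0"
      by (rule always_eventually) (rule allI, rule hat_tendsto)
    show "uniform_limit UNIV (\<lambda>n. apply_bcontfun (hat (X n))) f sequentially"
      by (rule tendsto_bcontfun_uniform_limit[OF f])
  qed simp_all
  then have "hat (Abs_c0 f) = f"
    by (simp add: Abs_c0_inverse)
  with f have "X \<longlonglongrightarrow> Abs_c0 f"
    using hat_LIMSEQ_iff[of X "Abs_c0 f"] by simp
  then show "convergent X" by (rule convergentI)
qed

subsection \<open>Absolutely summable sequences\<close>

typedef l1 = "{f :: nat \<Rightarrow> real. summable (\<lambda>n. \<bar>f n\<bar>)}"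
  morphisms l1_nth Abs_l1
  by (rule exI[of _ "\<lambda>_. 0"]) simp

setup_lifting type_definition_l1

instantiation l1 :: real_vector
begin

lift_definition zero_l1 :: l1 is "\<lambda>_. 0" by simp
lift_definition plus_l1 :: "l1 \<Rightarrow> l1 \<Rightarrow> l1" is "\<lambda>f g n. f n + g n"
proof -
  fix f g :: "nat \<Rightarrow> real"
  assume "summable (\<lambda>n. \<bar>f n\<bar>)" "summable (\<lambda>n. \<bar>g n\<bar>)"
  from summable_add[OF this] show "summable (\<lambda>n. \<bar>f n + g n\<bar>)"
    by (rule summable_comparison_test'[where N = 0]) auto
qed
lift_definition minus_l1 :: "l1 \<Rightarrow> l1 \<Rightarrow> l1" is "\<lambda>f g n. f n - g n"
proof -
  fix f g :: "nat \<Rightarrow> real"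
  assume "summable (\<lambda>n. \<bar>f n\<bar>)" "summable (\<lambda>n. \<bar>g n\<bar>)"
  from summable_add[OF this] show "summable (\<lambda>n. \<bar>f n - g n\<bar>)"
    by (rule summable_comparison_test'[where N = 0]) auto
qed
lift_definition uminus_l1 :: "l1 \<Rightarrow> l1" is "\<lambda>f n. - f n" by simp
lift_definition scaleR_l1 :: "real \<Rightarrow> l1 \<Rightarrow> l1" is "\<lambda>a f n. a * f n"
  by (simp add: abs_mult summable_mult)

instance
proof
  fix x y z :: l1 and a b :: real
  show "x + y + z = x + (y + z)" "x + y = y + x" "0 + x = x" "- x + x = 0" "x - y = x + - y"
    by (transfer; simp add: algebra_simps)+
  show "a *\<^sub>R (x + y) = a *\<^sub>R x + a *\<^sub>R y" "(a + b) *\<^sub>R x = a *\<^sub>R x + b *\<^sub>R x"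
    "a *\<^sub>R b *\<^sub>R x = (a * b) *\<^sub>R x" "1 *\<^sub>R x = x"
    by (transfer; simp add: algebra_simps)+
qed

end

instantiation l1 :: real_normed_vector
begin

lift_definition norm_l1 :: "l1 \<Rightarrow> real" is "\<lambda>f. \<Sum>n. \<bar>f n\<bar>" .
definition dist_l1 :: "l1 \<Rightarrow> l1 \<Rightarrow> real" where "dist_l1 x y = norm (x - y)"
definition sgn_l1 :: "l1 \<Rightarrow> l1" where "sgn_l1 x = x /\<^sub>R norm x"
definition uniformity_l1 :: "(l1 \<times> l1) filter"
  where "uniformity_l1 = (INF e\<in>{0 <..}. principal {(x, y). dist x y < e})"
definition open_l1 :: "l1 set \<Rightarrow> bool"
  where "open_l1 U = (\<forall>x\<in>U. \<forall>\<^sub>F (x', y) in uniformity. x' = x \<longrightarrow> y \<in> U)"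

instance
proof
  fix x y :: l1 and a :: real
  show "(norm x = 0) = (x = 0)"
    by transfer (auto simp: suminf_eq_zero_iff)
  show "norm (a *\<^sub>R x) = \<bar>a\<bar> * norm x"
    by transfer (simp add: abs_mult suminf_mult)
  show "norm (x + y) \<le> norm x + norm y"
  proof transfer
    fix f g :: "nat \<Rightarrow> real"
    assume s: "summable (\<lambda>n. \<bar>f n\<bar>)" "summable (\<lambda>n. \<bar>g n\<bar>)"
    have "summable (\<lambda>n. \<bar>f n + g n\<bar>)"
      by (rule summable_comparison_test'[OF summable_add[OF s]]) auto
    then show "(\<Sum>n. \<bar>f n + g n\<bar>) \<le> (\<Sum>n. \<bar>f n\<bar>) + (\<Sum>n. \<bar>g n\<bar>)"
      by (subst suminf_add[OF s]) (auto intro!: suminf_le summable_add s)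
  qed
qed (rule dist_l1_def sgn_l1_def uniformity_l1_def open_l1_def)+

end

lemma l1_nth_simps [simp]:
  "l1_nth 0 n = 0" "l1_nth (x + y) n = l1_nth x n + l1_nth y n"
  "l1_nth (x - y) n = l1_nth x n - l1_nth y n"
  "l1_nth (- x) n = - l1_nth x n" "l1_nth (a *\<^sub>R x) n = a * l1_nth x n"
  by (transfer; simp)+

lemma summable_l1: "summable (\<lambda>n. \<bar>l1_nth y n\<bar>)"
  using l1_nth[of y] by simp

lemma norm_l1_eq: "norm y = (\<Sum>n. \<bar>l1_nth y n\<bar>)"
  by transfer simp

lemma l1_eqI: "(\<And>n. l1_nth x n = l1_nth y n) \<Longrightarrow> x = y"
  by (simp add: ext l1_nth_inject[symmetric])

section \<open>The pairings\<close>

definition c0_pair :: "c0 \<Rightarrow> l1 \<Rightarrow> real"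
  where "c0_pair x y = (\<Sum>n. hat x n * l1_nth y n)"

definition l1_pair :: "l1 \<Rightarrow> linf \<Rightarrow> real"
  where "l1_pair y z = (\<Sum>n. l1_nth y n * z n)"

text \<open>The pairing \<open>p\<close> identifies \<^typ>\<open>'b\<close> isometrically with the full normed dual of \<^typ>\<open>'a\<close>.\<close>

definition realizes_dual :: "('a::real_normed_vector \<Rightarrow> 'b::real_normed_vector \<Rightarrow> real) \<Rightarrow> bool"
  where "realizes_dual p \<longleftrightarrow> bounded_bilinear p \<and> (\<forall>y. onorm (\<lambda>x. p x y) = norm y) \<and>
    (\<forall>f. bounded_linear f \<longrightarrow> (\<exists>!y. \<forall>x. f x = p x y))"

lemma l1_linf_abs_summable: "summable (\<lambda>n. \<bar>l1_nth y n * apply_bcontfun z n\<bar>)"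
  and l1_linf_bound: "\<bar>\<Sum>n. l1_nth y n * apply_bcontfun z n\<bar> \<le> norm y * norm z"
proof -
  have le: "\<bar>l1_nth y n * apply_bcontfun z n\<bar> \<le> \<bar>l1_nth y n\<bar> * norm z" for n
    using norm_bounded[of z n] by (auto simp: abs_mult intro!: mult_left_mono)
  have s: "summable (\<lambda>n. \<bar>l1_nth y n\<bar> * norm z)"
    by (rule summable_mult2[OF summable_l1])
  show s1: "summable (\<lambda>n. \<bar>l1_nth y n * apply_bcontfun z n\<bar>)"
    by (rule summable_comparison_test'[OF s]) (use le in auto)
  have "\<bar>\<Sum>n. l1_nth y n * apply_bcontfun z n\<bar> \<le> (\<Sum>n. \<bar>l1_nth y n * apply_bcontfun z n\<bar>)"
    by (rule summable_rabs[OF s1])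
  also have "\<dots> \<le> (\<Sum>n. \<bar>l1_nth y n\<bar> * norm z)"
    by (rule suminf_le[OF _ s1 s]) (rule le)
  also have "\<dots> = norm y * norm z"
    by (simp add: norm_l1_eq suminf_mult2[OF summable_l1])
  finally show "\<bar>\<Sum>n. l1_nth y n * apply_bcontfun z n\<bar> \<le> norm y * norm z" .
qed

lemma l1_linf_summable: "summable (\<lambda>n. l1_nth y n * apply_bcontfun z n)"
  by (rule summable_rabs_cancel[OF l1_linf_abs_summable])

lemma l1_pair_hat: "l1_pair y (hat x) = c0_pair x y"
  by (simp add: l1_pair_def c0_pair_def mult.commute)

lemma bounded_bilinear_l1_pair: "bounded_bilinear l1_pair"
proof
  show "\<exists>K. \<forall>a b. norm (l1_pair a b) \<le> norm a * norm b * K"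
    using l1_linf_bound by (intro exI[of _ 1]) (simp add: l1_pair_def)
qed (simp_all add: l1_pair_def distrib_left distrib_right mult.assoc mult.left_commute
    suminf_add[OF l1_linf_summable l1_linf_summable] suminf_mult[OF l1_linf_summable])

lemma bounded_bilinear_c0_pair: "bounded_bilinear c0_pair"
proof -
  interpret bounded_bilinear l1_pair by (rule bounded_bilinear_l1_pair)
  show ?thesis
  proof
    show "\<exists>K. \<forall>a b. norm (c0_pair a b) \<le> norm a * norm b * K"
      using l1_linf_bound[of _ "hat _"]
      by (intro exI[of _ 1]) (simp add: l1_pair_hat[symmetric] l1_pair_def mult.commute)
  qed (simp_all add: l1_pair_hat[symmetric] add_left add_right scaleR_left scaleR_right)
qed

lemma ex_c0_trunc: "\<exists>x. \<forall>n. hat x n = (if n < N then g n else 0)"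
proof -
  have "(\<lambda>n. if n < N then g n else (0::real)) \<longlonglongrightarrow> 0"
    by (rule tendsto_eventually) (auto simp: eventually_sequentially intro!: exI[of _ N])
  then show ?thesis
    by (rule null_seq_cases) (metis (no_types, lifting))
qed

definition c0_trunc :: "nat \<Rightarrow> (nat \<Rightarrow> real) \<Rightarrow> c0"
  where "c0_trunc N g = (SOME x. \<forall>n. hat x n = (if n < N then g n else 0))"

lemma hat_c0_trunc [simp]: "hat (c0_trunc N g) n = (if n < N then g n else 0)"
  using someI_ex[OF ex_c0_trunc[of N g]] by (simp add: c0_trunc_def)

definition c0_unit :: "nat \<Rightarrow> c0"
  where "c0_unit k = c0_trunc (Suc k) (\<lambda>n. if n = k then 1 else 0)"

lemma hat_c0_unit [simp]: "hat (c0_unit k) n = (if n = k then 1 else 0)"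
  by (simp add: c0_unit_def)

lemma linear_c0_trunc:
  assumes "bounded_linear f"
  shows "f (c0_trunc N g) = (\<Sum>n<N. g n *\<^sub>R f (c0_unit n))"
proof -
  interpret bounded_linear f by fact
  show ?thesis
  proof (induction N)
    case 0
    have "c0_trunc 0 g = 0" by (rule c0_eqI) simp
    then show ?case by (simp add: zero)
  next
    case (Suc N)
    have "c0_trunc (Suc N) g = c0_trunc N g + g N *\<^sub>R c0_unit N"
      by (rule c0_eqI) (auto simp: less_Suc_eq)
    then show ?case by (simp add: Suc add scaleR)
  qed
qed

lemma c0_trunc_tendsto: "(\<lambda>N. c0_trunc N (hat x)) \<longlonglongrightarrow> x"
proof (rule LIMSEQ_I)
  fix r :: real assume r: "0 < r"
  obtain N where N: "\<And>n. n \<ge> N \<Longrightarrow> \<bar>hat x n\<bar> < r / 2"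
    using LIMSEQ_D[OF hat_tendsto[of x], of "r/2"] r by auto
  have "norm (c0_trunc m (hat x) - x) < r" if m: "m \<ge> N" for m
  proof -
    have "norm (hat (c0_trunc m (hat x) - x)) \<le> r / 2"
      by (rule norm_bound) (use N m r in \<open>force simp: less_imp_le\<close>)
    then show ?thesis using r unfolding norm_hat by simp
  qed
  then show "\<exists>no. \<forall>n\<ge>no. norm (c0_trunc n (hat x) - x) < r" by blast
qed

lemma c0_functional:
  fixes f :: "c0 \<Rightarrow> real"
  assumes f: "bounded_linear f"
  obtains y where "\<And>x. f x = c0_pair x y" "norm y \<le> onorm f"
proof -
  define g where "g n = f (c0_unit n)" for n
  have part: "(\<Sum>n<N. \<bar>g n\<bar>) \<le> onorm f" for N
  proof -
    let ?x = "c0_trunc N (\<lambda>n. sgn (g n))"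
    have "norm (hat ?x) \<le> 1"
      by (rule norm_bound) (auto simp: abs_sgn_eq)
    moreover have "f ?x = (\<Sum>n<N. \<bar>g n\<bar>)"
      by (subst linear_c0_trunc[OF f]) (simp add: g_def abs_sgn mult.commute)
    moreover have "\<bar>f ?x\<bar> \<le> onorm f * norm ?x"
      using onorm[OF f, of ?x] by simp
    moreover have "onorm f * norm ?x \<le> onorm f"
      using calculation(1) onorm_pos_le[OF f] by (simp add: mult_left_le)
    ultimately show ?thesis by linarith
  qed
  have s: "summable (\<lambda>n. \<bar>g n\<bar>)"
    by (rule bounded_imp_summable[OF _ part[of "Suc _", unfolded lessThan_Suc_atMost]]) simp
  define y where "y = Abs_l1 g"
  have y: "l1_nth y = g"
    using s by (simp add: y_def Abs_l1_inverse)
  show ?thesis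
  proof
    show "norm y \<le> onorm f"
      unfolding norm_l1_eq y using part by (intro suminf_le_const s)
    fix x
    have "(\<lambda>N. f (c0_trunc N (hat x))) \<longlonglongrightarrow> f x"
      by (rule bounded_linear.tendsto[OF f c0_trunc_tendsto])
    then have "(\<lambda>n. hat x n * g n) sums f x"
      by (simp add: linear_c0_trunc[OF f] sums_def g_def)
    then show "f x = c0_pair x y"
      by (simp add: c0_pair_def y sums_iff)
  qed
qed

lemma c0_pair_unit: "c0_pair (c0_unit k) y = l1_nth y k"
proof -
  have "(\<lambda>n. hat (c0_unit k) n * l1_nth y n) = (\<lambda>n. if n = k then l1_nth y n else 0)"
    by auto
  then show ?thesis
    using sums_single[of k "l1_nth y"] by (simp add: c0_pair_def sums_iff)
qed

lemma c0_pair_inj: "(\<And>x. c0_pair x y = c0_pair x y') \<Longrightarrow> y = y'"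
  by (rule l1_eqI) (metis c0_pair_unit)

lemma abs_c0_pair_le: "\<bar>c0_pair x y\<bar> \<le> norm y * norm x"
  using l1_linf_bound[of y "hat x"] by (simp add: l1_pair_hat[symmetric] l1_pair_def)

lemma onorm_c0_pair: "onorm (\<lambda>x. c0_pair x y) = norm y"
proof (rule antisym)
  have bl: "bounded_linear (\<lambda>x. c0_pair x y)"
    by (rule bounded_bilinear.bounded_linear_left[OF bounded_bilinear_c0_pair])
  show "onorm (\<lambda>x. c0_pair x y) \<le> norm y"
    by (rule onorm_bound) (simp_all add: abs_c0_pair_le)
  obtain y' where "\<And>x. c0_pair x y = c0_pair x y'" "norm y' \<le> onorm (\<lambda>x. c0_pair x y)"
    using c0_functional[OF bl] by blast
  moreover from this(1) have "y = y'" by (rule c0_pair_inj)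
  ultimately show "norm y \<le> onorm (\<lambda>x. c0_pair x y)" by simp
qed

theorem realizes_dual_c0_pair: "realizes_dual c0_pair"
  unfolding realizes_dual_def
proof (intro conjI allI impI bounded_bilinear_c0_pair onorm_c0_pair)
  fix f :: "c0 \<Rightarrow> real" assume "bounded_linear f"
  then obtain y where "\<And>x. f x = c0_pair x y" using c0_functional by blast
  then show "\<exists>!y. \<forall>x. f x = c0_pair x y"
    by (metis c0_pair_inj)
qed

text \<open>Completeness of \<^typ>\<open>l1\<close>, by way of the dual of \<^typ>\<open>c0\<close>.\<close>

instance l1 :: banach
proof
  fix X :: "nat \<Rightarrow> l1"
  assume X: "Cauchy X"
  define J where "J y = Blinfun (\<lambda>x. c0_pair x y)" for y
  have bl: "bounded_linear (\<lambda>x. c0_pair x y)" for y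
    by (rule bounded_bilinear.bounded_linear_left[OF bounded_bilinear_c0_pair])
  have J: "blinfun_apply (J y) x = c0_pair x y" for x y
    by (simp add: J_def bounded_linear_Blinfun_apply[OF bl])
  have J_diff: "J (y - z) = J y - J z" for y z
    by (rule blinfun_eqI)
      (simp add: J blinfun.diff_left bounded_bilinear.diff_right[OF bounded_bilinear_c0_pair])
  have norm_J: "norm (J y) = norm y" for y
    unfolding norm_blinfun.rep_eq J by (rule onorm_c0_pair)
  have "Cauchy (\<lambda>n. J (X n))"
    using X by (simp add: Cauchy_def dist_norm J_diff[symmetric] norm_J)
  then have "convergent (\<lambda>n. J (X n))" by (rule Cauchy_convergent)
  then obtain F where F: "(\<lambda>n. J (X n)) \<longlonglongrightarrow> F"
    unfolding convergent_def by (rule exE)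
  obtain y where "\<And>x. blinfun_apply F x = c0_pair x y"
    using c0_functional[OF blinfun.bounded_linear_right[of F]] by blast
  then have "F = J y" by (intro blinfun_eqI) (simp add: J)
  with F have "X \<longlonglongrightarrow> y"
    by (simp add: LIMSEQ_iff J_diff[symmetric] norm_J)
  then show "convergent X" by (rule convergentI)
qed

lemma ex_l1_trunc: "\<exists>x. \<forall>n. l1_nth x n = (if n < N then g n else 0)"
proof -
  have "summable (\<lambda>n. \<bar>if n < N then g n else (0::real)\<bar>)"
    by (rule summable_finite[of "{..<N}"]) auto
  then show ?thesis
    by (intro exI[of _ "Abs_l1 (\<lambda>n. if n < N then g n else 0)"]) (simp add: Abs_l1_inverse)
qed

definition l1_trunc :: "nat \<Rightarrow> (nat \<Rightarrow> real) \<Rightarrow> l1"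
  where "l1_trunc N g = (SOME x. \<forall>n. l1_nth x n = (if n < N then g n else 0))"

lemma l1_nth_trunc [simp]: "l1_nth (l1_trunc N g) n = (if n < N then g n else 0)"
  using someI_ex[OF ex_l1_trunc[of N g]] by (simp add: l1_trunc_def)

definition l1_unit :: "nat \<Rightarrow> l1"
  where "l1_unit k = l1_trunc (Suc k) (\<lambda>n. if n = k then 1 else 0)"

lemma l1_nth_unit [simp]: "l1_nth (l1_unit k) n = (if n = k then 1 else 0)"
  by (simp add: l1_unit_def)

lemma norm_l1_unit [simp]: "norm (l1_unit k) = 1"
proof -
  have "(\<lambda>n. \<bar>l1_nth (l1_unit k) n\<bar>) = (\<lambda>n. if n = k then 1 else 0)" by auto
  then show ?thesis
    using sums_single[of k "\<lambda>_. 1::real"] by (simp add: norm_l1_eq sums_iff)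
qed

lemma linear_l1_trunc:
  assumes "bounded_linear f"
  shows "f (l1_trunc N g) = (\<Sum>n<N. g n *\<^sub>R f (l1_unit n))"
proof -
  interpret bounded_linear f by fact
  show ?thesis
  proof (induction N)
    case 0
    have "l1_trunc 0 g = 0" by (rule l1_eqI) simp
    then show ?case by (simp add: zero)
  next
    case (Suc N)
    have "l1_trunc (Suc N) g = l1_trunc N g + g N *\<^sub>R l1_unit N"
      by (rule l1_eqI) (auto simp: less_Suc_eq)
    then show ?case by (simp add: Suc add scaleR)
  qed
qed

lemma l1_trunc_tendsto: "(\<lambda>N. l1_trunc N (l1_nth y)) \<longlonglongrightarrow> y"
proof -
  have eq: "norm (l1_trunc N (l1_nth y) - y) = (\<Sum>n. \<bar>l1_nth y (n + N)\<bar>)" for N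
  proof -
    have "(\<Sum>n. \<bar>l1_nth (l1_trunc N (l1_nth y) - y) n\<bar>) =
      (\<Sum>n. \<bar>l1_nth (l1_trunc N (l1_nth y) - y) (n + N)\<bar>) +
      (\<Sum>n<N. \<bar>l1_nth (l1_trunc N (l1_nth y) - y) n\<bar>)"
      by (rule suminf_split_initial_segment[OF summable_l1])
    then show ?thesis by (simp add: norm_l1_eq)
  qed
  have "(\<lambda>N. norm (l1_trunc N (l1_nth y) - y)) \<longlonglongrightarrow> 0"
    unfolding eq by (rule suminf_exist_split2[OF summable_l1])
  then show ?thesis
    by (simp add: LIM_zero_cancel tendsto_norm_zero_iff)
qed

lemma l1_functional:
  fixes f :: "l1 \<Rightarrow> real"
  assumes f: "bounded_linear f"
  obtains z where "\<And>y. f y = l1_pair y z" "norm z \<le> onorm f"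
proof -
  define g where "g n = f (l1_unit n)" for n
  have g: "\<bar>g n\<bar> \<le> onorm f" for n
    using onorm[OF f, of "l1_unit n"] by (simp add: g_def)
  then have "bounded (range g)"
    by (auto simp: bounded_iff)
  then have z: "apply_bcontfun (Bcontfun g) = g"
    by (rule Bcontfun_inverse_nat)
  show ?thesis
  proof
    show "norm (Bcontfun g) \<le> onorm f"
      by (rule norm_bound) (simp add: z g)
    fix y
    have "(\<lambda>N. f (l1_trunc N (l1_nth y))) \<longlonglongrightarrow> f y"
      by (rule bounded_linear.tendsto[OF f l1_trunc_tendsto])
    then have "(\<lambda>n. l1_nth y n * g n) sums f y"
      by (simp add: linear_l1_trunc[OF f] sums_def g_def)
    then show "f y = l1_pair y (Bcontfun g)"
      by (simp add: l1_pair_def z sums_iff)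
  qed
qed

lemma l1_pair_unit: "l1_pair (l1_unit k) z = apply_bcontfun z k"
proof -
  have "(\<lambda>n. l1_nth (l1_unit k) n * z n) = (\<lambda>n. if n = k then z n else 0)"
    by auto
  then show ?thesis
    using sums_single[of k "apply_bcontfun z"] by (simp add: l1_pair_def sums_iff)
qed

lemma l1_pair_inj: "(\<And>y. l1_pair y z = l1_pair y z') \<Longrightarrow> z = z'"
  by (rule bcontfun_eqI) (metis l1_pair_unit)

lemma onorm_l1_pair: "onorm (\<lambda>y. l1_pair y z) = norm z"
proof (rule antisym)
  have bl: "bounded_linear (\<lambda>y. l1_pair y z)"
    by (rule bounded_bilinear.bounded_linear_left[OF bounded_bilinear_l1_pair])
  show "onorm (\<lambda>y. l1_pair y z) \<le> norm z"
    using l1_linf_bound[of _ z] by (intro onorm_bound) (simp_all add: l1_pair_def mult.commute)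
  obtain z' where "\<And>y. l1_pair y z = l1_pair y z'" "norm z' \<le> onorm (\<lambda>y. l1_pair y z)"
    using l1_functional[OF bl] by blast
  moreover from this(1) have "z = z'" by (rule l1_pair_inj)
  ultimately show "norm z \<le> onorm (\<lambda>y. l1_pair y z)" by simp
qed

theorem realizes_dual_l1_pair: "realizes_dual l1_pair"
  unfolding realizes_dual_def
proof (intro conjI allI impI bounded_bilinear_l1_pair onorm_l1_pair)
  fix f :: "l1 \<Rightarrow> real" assume "bounded_linear f"
  then obtain z where "\<And>y. f y = l1_pair y z" using l1_functional by blast
  then show "\<exists>!z. \<forall>y. f y = l1_pair y z"
    by (metis l1_pair_inj)
qed

section \<open>Multifunctions\<close>

text \<open>A multifunction from a Banach space \<open>F\<close> to its dual is a function \<open>'a \<Rightarrow> 'b set\<close>, where the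
  second space is the dual of the first through the pairing \<open>p\<close>, i.e. \<open>realizes_dual p\<close>.
  Infima and suprema are taken in the extended reals, so that the infimum over an empty graph
  is \<open>\<infinity>\<close> and the functions \<open>fitzpatrick\<close> and \<open>fitzpatrick_conj\<close> may take infinite values.\<close>

definition graph :: "('a \<Rightarrow> 'b set) \<Rightarrow> ('a \<times> 'b) set"
  where "graph U = {(x, x'). x' \<in> U x}"

definition monotone_set :: "('a::banach \<Rightarrow> 'b::banach \<Rightarrow> real) \<Rightarrow> ('a \<times> 'b) set \<Rightarrow> bool"
  where "monotone_set p A \<longleftrightarrow> (\<forall>(x, x')\<in>A. \<forall>(y, y')\<in>A. p (x - y) (x' - y') \<ge> 0)"

definition maximally_monotone_set :: "('a::banach \<Rightarrow> 'b::banach \<Rightarrow> real) \<Rightarrow> ('a \<times> 'b) set \<Rightarrow> bool"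
  where "maximally_monotone_set p A \<longleftrightarrow>
    monotone_set p A \<and> (\<forall>B. monotone_set p B \<and> A \<subseteq> B \<longrightarrow> B = A)"

definition maximally_monotone :: "('a::banach \<Rightarrow> 'b::banach \<Rightarrow> real) \<Rightarrow> ('a \<Rightarrow> 'b set) \<Rightarrow> bool"
  where "maximally_monotone p U \<longleftrightarrow> maximally_monotone_set p (graph U)"

definition quasidense :: "('a::banach \<Rightarrow> 'b::banach \<Rightarrow> real) \<Rightarrow> ('a \<Rightarrow> 'b set) \<Rightarrow> bool"
  where "quasidense p U \<longleftrightarrow> (\<forall>x x'. (INF (s, s')\<in>graph U.
    ereal (1/2 * (norm (s - x))\<^sup>2 + 1/2 * (norm (s' - x'))\<^sup>2 + p (s - x) (s' - x'))) \<le> 0)"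

text \<open>Below, \<open>p\<close> is the pairing of \<open>E\<close> with its dual, and \<open>q\<close> that of the dual with the bidual.\<close>

definition fitzpatrick ::
    "('a::banach \<Rightarrow> 'b::banach \<Rightarrow> real) \<Rightarrow> ('a \<Rightarrow> 'b set) \<Rightarrow> 'a \<Rightarrow> 'b \<Rightarrow> ereal"
  where "fitzpatrick p S x x' = (SUP (s, s')\<in>graph S. ereal (p s x' + p x s' - p s s'))"

definition fitzpatrick_conj ::
    "('a::banach \<Rightarrow> 'b::banach \<Rightarrow> real) \<Rightarrow> ('b \<Rightarrow> 'c::banach \<Rightarrow> real) \<Rightarrow> ('a \<Rightarrow> 'b set) \<Rightarrow> 'b \<Rightarrow> 'c \<Rightarrow> ereal"
  where "fitzpatrick_conj p q S y' y'' =
    (SUP (x, x')\<in>UNIV. ereal (p x y' + q x' y'') - fitzpatrick p S x x')"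

definition fitzpatrick_ext ::
    "('a::banach \<Rightarrow> 'b::banach \<Rightarrow> real) \<Rightarrow> ('b \<Rightarrow> 'c::banach \<Rightarrow> real) \<Rightarrow> ('a \<Rightarrow> 'b set) \<Rightarrow> 'b \<Rightarrow> 'c set"
  where "fitzpatrick_ext p q S y' = {y''. fitzpatrick_conj p q S y' y'' = ereal (q y' y'')}"

section \<open>The operators\<close>

definition tail_sum :: "l1 \<Rightarrow> nat \<Rightarrow> real"
  where "tail_sum y j = (\<Sum>i. l1_nth y (j + i))"

definition T_op :: "l1 \<Rightarrow> linf"
  where "T_op y = Bcontfun (\<lambda>j. tail_sum y j + tail_sum y (Suc j))"

definition S_op :: "c0 \<Rightarrow> l1 set"
  where "S_op x = {y. hat x = T_op y}"

lemma abs_tail_sum_le: "\<bar>tail_sum y j\<bar> \<le> norm y"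
proof -
  have s: "summable (\<lambda>i. \<bar>l1_nth y (j + i)\<bar>)"
    using summable_ignore_initial_segment[OF summable_l1, of y j] by (simp add: add.commute)
  have "\<bar>tail_sum y j\<bar> \<le> (\<Sum>i. \<bar>l1_nth y (j + i)\<bar>)"
    unfolding tail_sum_def by (rule summable_rabs[OF s])
  also have "\<dots> \<le> norm y"
    using suminf_split_initial_segment[OF summable_l1, of y j]
    by (simp add: norm_l1_eq add.commute sum_nonneg)
  finally show ?thesis .
qed

text \<open>The sequence in the definition of \<open>T_op\<close> is bounded, so \<open>Bcontfun\<close> applies to it as intended.\<close>

lemma T_op_apply: "apply_bcontfun (T_op y) j = tail_sum y j + tail_sum y (Suc j)"
proof -
  have "\<bar>tail_sum y j + tail_sum y (Suc j)\<bar> \<le> norm y + norm y" for j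
    using abs_tail_sum_le[of y j] abs_tail_sum_le[of y "Suc j"] by linarith
  then have "bounded (range (\<lambda>j. tail_sum y j + tail_sum y (Suc j)))"
    by (auto simp: bounded_iff)
  then show ?thesis by (simp add: T_op_def Bcontfun_inverse_nat)
qed

end

theory Submission
  imports Defs
begin

text \<open>
  Write \<open>\<tau>\<close> for the sequence of tails of \<open>y \<in> \<ell>\<^sub>1\<close>. As \<open>y j = \<tau> j - \<tau> (j + 1)\<close>, the products
  \<open>y j * (T y) j = (\<tau> j)\<^sup>2 - (\<tau> (j + 1))\<^sup>2\<close> telescope, so that \<open>\<langle>y, T y\<rangle> = (\<Sum>i. y i)\<^sup>2\<close>: up to
  a skew part, \<open>T\<close> is the rank-one operator that sends \<open>y\<close> to the constant sequence \<open>\<Sum>i. y i\<close>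
  (\<open>l1_pair_T_op\<close>). In particular it is monotone, and a linear monotone operator defined on the
  whole space is maximal: a pair \<open>(z, v)\<close> monotonically related to its graph satisfies \<open>v = T z\<close>
  (\<open>monotonically_related_imp_T_op\<close>).

  The tails tend to \<open>0\<close>, so \<open>T\<close> takes its values in \<open>c\<^sub>0\<close>, and the graph of \<open>S\<close> is the transposed
  graph of \<open>T\<close>. Hence \<open>S\<close> is maximally monotone as well. The conjugate of the Fitzpatrick function
  of \<open>S\<close> at \<open>(y, v)\<close> dominates \<open>\<langle>y, T z\<rangle> + \<langle>z, v\<rangle> - \<langle>z, T z\<rangle>\<close> for every \<open>z \<in> \<ell>\<^sub>1\<close>. Where it equals
  \<open>\<langle>y, v\<rangle>\<close>, these inequalities say that \<open>(y, v)\<close> is monotonically related to the graph of \<open>T\<close>,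
  which forces \<open>v = T y\<close> (\<open>fitzpatrick_ext_S_op\<close>).

  Quasidensity separates the two operators. After a translation it asks, for a given \<open>u\<close>, for
  some \<open>w \<in> \<ell>\<^sub>1\<close> that makes
  \<open>\<parallel>w\<parallel>\<^sup>2 / 2 + \<parallel>T w + u\<parallel>\<^sup>2 / 2 + \<langle>w, T w + u\<rangle>\<close> small.
  \<^item> For \<open>T\<close>, where \<open>u\<close> may be any bounded sequence, the choice \<open>u = -1\<close> is an obstruction: with
    \<open>t = \<Sum>i. w i\<close> the three terms are at least \<open>t\<^sup>2 / 2\<close>, \<open>1 / 2\<close> (because \<open>T w\<close> tends to \<open>0\<close>) and
    \<open>t\<^sup>2 - t\<close>, and their sum is at least \<open>1 / 3\<close>.
  \<^item> For \<open>S\<close>, where \<open>u\<close> is a null sequence, one solves the problem on the first \<open>N\<close> coordinates,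
    which amounts to finding a number \<open>r\<close> such that \<open>\<parallel>w\<parallel> = r\<close>, \<open>\<bar>T w + u\<bar> \<le> r\<close>, and \<open>w j \<noteq> 0\<close> only
    where \<open>T w + u\<close> takes the value \<open>\<plusminus>r\<close> of the opposite sign. For given \<open>r\<close> the tails of \<open>w\<close>
    are forced, and can be computed backwards from \<open>\<tau> N = 0\<close>: the tail stays constant while the
    constraint \<open>\<bar>T w + u\<bar> \<le> r\<close> allows it, and otherwise moves just enough to restore it
    (\<open>backward_play\<close>). The total variation of this sequence, which is \<open>\<parallel>w\<parallel>\<close>, depends
    continuously on \<open>r\<close> and vanishes for \<open>r = \<parallel>u\<parallel>\<close>, so the intermediate value theorem yields
    an \<open>r\<close> with \<open>\<parallel>w\<parallel> = r\<close> (\<open>truncated_duality_inclusion\<close>).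
\<close>

section \<open>Tails of summable sequences\<close>

interpretation l1_pair: bounded_bilinear l1_pair
  by (rule bounded_bilinear_l1_pair)

lemma summable_l1_shift: "summable (\<lambda>i. l1_nth y (j + i))"
  using summable_ignore_initial_segment[OF summable_rabs_cancel[OF summable_l1], of y j]
  by (simp add: add.commute)

lemma tail_sum_add: "tail_sum (y + z) j = tail_sum y j + tail_sum z j"
  by (simp add: tail_sum_def suminf_add[OF summable_l1_shift summable_l1_shift])

lemma tail_sum_scaleR: "tail_sum (a *\<^sub>R y) j = a * tail_sum y j"
  by (simp add: tail_sum_def suminf_mult[OF summable_l1_shift])

lemma tail_sum_Suc: "tail_sum y j = l1_nth y j + tail_sum y (Suc j)"
  using suminf_split_head[OF summable_l1_shift, of y j] by (simp add: tail_sum_def)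

lemma tail_sum_tendsto_0: "tail_sum y \<longlonglongrightarrow> 0"
  using suminf_exist_split2[OF summable_rabs_cancel[OF summable_l1], of y]
  by (simp add: tail_sum_def[abs_def] add.commute)

text \<open>A null sequence is determined by its increments.\<close>

lemma tail_sum_telescope:
  assumes "\<And>j. l1_nth y j = b j - b (Suc j)" and "b \<longlonglongrightarrow> 0"
  shows "tail_sum y j = b j"
proof -
  have "(\<lambda>i. b (j + i)) \<longlonglongrightarrow> 0"
    using LIMSEQ_ignore_initial_segment[OF assms(2), of j] by (simp add: add.commute)
  from telescope_sums'[OF this] show ?thesis
    by (simp add: tail_sum_def assms(1) sums_iff)
qed

section \<open>The operator and its quadratic form\<close>

lemma linear_T_op: "linear T_op"
  by (rule linearI; rule bcontfun_eqI)
    (simp_all add: T_op_apply tail_sum_add tail_sum_scaleR algebra_simps)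

lemmas T_op_add = linear_add[OF linear_T_op]
  and T_op_diff = linear_diff[OF linear_T_op]
  and T_op_scaleR = linear_scale[OF linear_T_op]

lemma T_op_tendsto_0: "apply_bcontfun (T_op y) \<longlonglongrightarrow> 0"
proof -
  have "(\<lambda>j. tail_sum y j + tail_sum y (Suc j)) \<longlonglongrightarrow> 0 + 0"
    by (intro tendsto_add tail_sum_tendsto_0 LIMSEQ_Suc)
  then show ?thesis by (simp add: T_op_apply[abs_def])
qed

definition T_c0 :: "l1 \<Rightarrow> c0"
  where "T_c0 y = Abs_c0 (T_op y)"

lemma hat_T_c0 [simp]: "hat (T_c0 y) = T_op y"
  by (simp add: T_c0_def Abs_c0_inverse T_op_tendsto_0)

lemma c0_pair_T_c0: "c0_pair (T_c0 y) z = l1_pair z (T_op y)"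
  by (simp add: l1_pair_hat[symmetric])

lemma graph_S_op: "graph S_op = range (\<lambda>y. (T_c0 y, y))"
  by (auto simp: graph_def S_op_def image_iff hat_inject[symmetric])

lemma l1_pair_T_op: "l1_pair y (T_op y) = (tail_sum y 0)\<^sup>2"
proof -
  have "(\<lambda>j. (tail_sum y j)\<^sup>2) \<longlonglongrightarrow> 0"
    using tendsto_power[OF tail_sum_tendsto_0, of y 2] by simp
  from telescope_sums'[OF this]
  have "(\<lambda>j. (tail_sum y j)\<^sup>2 - (tail_sum y (Suc j))\<^sup>2) sums (tail_sum y 0)\<^sup>2" by simp
  moreover have "(tail_sum y j)\<^sup>2 - (tail_sum y (Suc j))\<^sup>2 = l1_nth y j * T_op y j" for j
    using tail_sum_Suc[of y j] by (simp add: T_op_apply power2_eq_square algebra_simps)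
  ultimately show ?thesis
    by (simp add: l1_pair_def sums_iff)
qed

section \<open>Maximal monotonicity\<close>

lemma T_op_monotone: "l1_pair (y - z) (T_op y - T_op z) \<ge> 0"
  by (simp add: T_op_diff[symmetric] l1_pair_T_op)

text \<open>Testing the relation at \<open>y = z + t h\<close> gives \<open>t \<langle>h, T z - v\<rangle> + t\<^sup>2 \<langle>h, T h\<rangle> \<ge> 0\<close> for every real
  \<open>t\<close>, so the linear coefficient has to vanish in each direction \<open>h\<close>.\<close>

lemma monotonically_related_imp_T_op:
  assumes related: "\<And>y. l1_pair (y - z) (T_op y - v) \<ge> 0"
  shows "v = T_op z"
proof (rule l1_pair_inj)
  fix h
  define a where "a = l1_pair h (T_op z - v)"
  define b where "b = l1_pair h (T_op h)"
  have b: "b \<ge> 0" by (simp add: b_def l1_pair_T_op)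
  have quad: "t * a + t\<^sup>2 * b \<ge> 0" for t
  proof -
    have "T_op (z + t *\<^sub>R h) - v = (T_op z - v) + t *\<^sub>R T_op h"
      by (simp add: T_op_add T_op_scaleR)
    then show ?thesis
      using related[of "z + t *\<^sub>R h"]
      by (simp add: a_def b_def l1_pair.add_right l1_pair.diff_right l1_pair.scaleR_left
          l1_pair.scaleR_right power2_eq_square algebra_simps)
  qed
  \<comment> \<open>With this \<open>t\<close> the quadratic has the value \<open>- a\<^sup>2 / (b + 1)\<^sup>2\<close>.\<close>
  define t where "t = - a / (b + 1)"
  have t: "(b + 1) * t = - a" using b by (simp add: t_def)
  have "(b + 1)\<^sup>2 * (t * a + t\<^sup>2 * b) = (b + 1) * ((b + 1) * t) * a + ((b + 1) * t)\<^sup>2 * b"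
    by (simp add: power2_eq_square algebra_simps)
  also have "\<dots> = - a\<^sup>2"
    unfolding t by (simp add: power2_eq_square algebra_simps)
  finally have "- a\<^sup>2 \<ge> 0"
    using quad[of t] by (metis mult_nonneg_nonneg zero_le_power2)
  then have "a = 0" by simp
  then show "l1_pair h v = l1_pair h (T_op z)"
    by (simp add: a_def l1_pair.diff_right)
qed

lemma maximally_monotone_T_op: "maximally_monotone l1_pair (\<lambda>y. {T_op y})"
proof -
  have "monotone_set l1_pair (graph (\<lambda>y. {T_op y}))"
    by (auto simp: monotone_set_def graph_def T_op_monotone)
  moreover have "B = graph (\<lambda>y. {T_op y})"
    if B: "monotone_set l1_pair B" "graph (\<lambda>y. {T_op y}) \<subseteq> B" for B
  proof -
    have "v = T_op z" if "(z, v) \<in> B" for z v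
    proof (rule monotonically_related_imp_T_op)
      fix y
      have "(y, T_op y) \<in> B" using B(2) by (auto simp: graph_def)
      with that B(1) show "l1_pair (y - z) (T_op y - v) \<ge> 0"
        by (auto simp: monotone_set_def)
    qed
    with B(2) show ?thesis by (auto simp: graph_def)
  qed
  ultimately show ?thesis
    by (auto simp: maximally_monotone_def maximally_monotone_set_def)
qed

lemma maximally_monotone_S_op: "maximally_monotone c0_pair S_op"
proof -
  have "monotone_set c0_pair (graph S_op)"
    by (auto simp: monotone_set_def graph_S_op l1_pair_hat[symmetric] T_op_monotone)
  moreover have "B = graph S_op" if B: "monotone_set c0_pair B" "graph S_op \<subseteq> B" for B
  proof -
    have "hat x = T_op z" if "(x, z) \<in> B" for x z
    proof (rule monotonically_related_imp_T_op)
      fix y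
      have "(T_c0 y, y) \<in> B" using B(2) by (auto simp: graph_S_op)
      with that B(1) have "c0_pair (T_c0 y - x) (y - z) \<ge> 0"
        by (auto simp: monotone_set_def)
      then show "l1_pair (y - z) (T_op y - hat x) \<ge> 0"
        by (simp add: l1_pair_hat[symmetric])
    qed
    with B(2) show ?thesis by (auto simp: graph_def S_op_def)
  qed
  ultimately show ?thesis
    by (auto simp: maximally_monotone_def maximally_monotone_set_def)
qed

section \<open>The Fitzpatrick extension\<close>

lemma fitzpatrick_S_op_ge:
  "fitzpatrick c0_pair S_op x z \<ge> ereal (l1_pair z (T_op y) + c0_pair x y - l1_pair y (T_op y))"
  unfolding fitzpatrick_def graph_S_op
  by (rule SUP_upper2[of "(T_c0 y, y)"]) (auto simp: c0_pair_T_c0)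

text \<open>Monotonicity of the graph says exactly that no term of the supremum exceeds the pairing.\<close>

lemma fitzpatrick_S_op_graph_le:
  "fitzpatrick c0_pair S_op (T_c0 y) y \<le> ereal (l1_pair y (T_op y))"
  unfolding fitzpatrick_def graph_S_op
proof (rule SUP_least, clarsimp simp: c0_pair_T_c0)
  fix z
  show "l1_pair y (T_op z) + l1_pair z (T_op y) - l1_pair z (T_op z) \<le> l1_pair y (T_op y)"
    using T_op_monotone[of y z] by (simp add: l1_pair.diff_left l1_pair.diff_right)
qed

lemma fitzpatrick_conj_S_op_ge:
  "fitzpatrick_conj c0_pair l1_pair S_op y v \<ge>
    ereal (l1_pair y (T_op z) + l1_pair z v - l1_pair z (T_op z))"
  unfolding fitzpatrick_conj_def
proof (rule SUP_upper2[of "(T_c0 z, z)"], simp, clarsimp simp: c0_pair_T_c0)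
  have "ereal (l1_pair y (T_op z) + l1_pair z v) - ereal (l1_pair z (T_op z)) \<le>
      ereal (l1_pair y (T_op z) + l1_pair z v) - fitzpatrick c0_pair S_op (T_c0 z) z"
    by (rule ereal_minus_mono[OF order_refl fitzpatrick_S_op_graph_le])
  then show "ereal (l1_pair y (T_op z) + l1_pair z v - l1_pair z (T_op z)) \<le>
      ereal (l1_pair y (T_op z) + l1_pair z v) - fitzpatrick c0_pair S_op (T_c0 z) z"
    by simp
qed

text \<open>Bounding the Fitzpatrick function from below by its term at \<open>y\<close> itself cancels the
  dependence of the supremum on the point \<open>(x, z)\<close>.\<close>

lemma fitzpatrick_conj_S_op_le:
  "fitzpatrick_conj c0_pair l1_pair S_op y (T_op y) \<le> ereal (l1_pair y (T_op y))"
  unfolding fitzpatrick_conj_def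
proof (rule SUP_least, clarsimp)
  fix x z
  have "ereal (c0_pair x y + l1_pair z (T_op y)) - fitzpatrick c0_pair S_op x z \<le>
      ereal (c0_pair x y + l1_pair z (T_op y)) -
      ereal (l1_pair z (T_op y) + c0_pair x y - l1_pair y (T_op y))"
    by (rule ereal_minus_mono[OF order_refl fitzpatrick_S_op_ge])
  then show "ereal (c0_pair x y + l1_pair z (T_op y)) - fitzpatrick c0_pair S_op x z \<le>
      ereal (l1_pair y (T_op y))"
    by simp
qed

lemma fitzpatrick_ext_S_op: "fitzpatrick_ext c0_pair l1_pair S_op = (\<lambda>y. {T_op y})"
proof (rule ext, intro set_eqI iffI)
  fix y v assume "v \<in> fitzpatrick_ext c0_pair l1_pair S_op y"
  then have eq: "fitzpatrick_conj c0_pair l1_pair S_op y v = ereal (l1_pair y v)"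
    by (simp add: fitzpatrick_ext_def)
  have "v = T_op y"
  proof (rule monotonically_related_imp_T_op)
    fix z
    have "l1_pair y (T_op z) + l1_pair z v - l1_pair z (T_op z) \<le> l1_pair y v"
      using fitzpatrick_conj_S_op_ge[of y z v] by (simp add: eq)
    then show "l1_pair (z - y) (T_op z - v) \<ge> 0"
      by (simp add: l1_pair.diff_left l1_pair.diff_right)
  qed
  then show "v \<in> {T_op y}" by simp
next
  fix y v assume "v \<in> {T_op y}"
  then show "v \<in> fitzpatrick_ext c0_pair l1_pair S_op y"
    using fitzpatrick_conj_S_op_le[of y] fitzpatrick_conj_S_op_ge[of y y "T_op y"]
    by (auto simp: fitzpatrick_ext_def intro: antisym)
qed

section \<open>Failure of quasidensity on the dual\<close>

lemma not_quasidense_T_op: "\<not> quasidense l1_pair (\<lambda>y. {T_op y})"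
proof
  let ?e = "const_bcontfun 1 :: linf"
  assume "quasidense l1_pair (\<lambda>y. {T_op y})"
  then have "(INF (s, s')\<in>graph (\<lambda>y. {T_op y}). ereal (1/2 * (norm (s - 0))\<^sup>2 +
      1/2 * (norm (s' - ?e))\<^sup>2 + l1_pair (s - 0) (s' - ?e))) \<le> 0"
    unfolding quasidense_def by blast
  moreover have "(INF (s, s')\<in>graph (\<lambda>y. {T_op y}). ereal (1/2 * (norm (s - 0))\<^sup>2 +
      1/2 * (norm (s' - ?e))\<^sup>2 + l1_pair (s - 0) (s' - ?e))) \<ge> ereal (1/3)"
  proof (rule INF_greatest)
    fix p assume "p \<in> graph (\<lambda>y. {T_op y})"
    then obtain w where p: "p = (w, T_op w)" by (auto simp: graph_def)
    define t where "t = tail_sum w 0"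
    have "t\<^sup>2 \<le> (norm w)\<^sup>2"
      using abs_tail_sum_le[of w 0] by (simp add: t_def abs_le_square_iff[symmetric])
    moreover have "1 \<le> norm (T_op w - ?e)"
    proof (rule LIMSEQ_le_const2)
      have "(\<lambda>j. \<bar>T_op w j - 1\<bar>) \<longlonglongrightarrow> \<bar>0 - 1\<bar>"
        by (intro tendsto_intros T_op_tendsto_0)
      then show "(\<lambda>j. \<bar>T_op w j - 1\<bar>) \<longlonglongrightarrow> 1" by simp
      show "\<exists>N. \<forall>j\<ge>N. \<bar>T_op w j - 1\<bar> \<le> norm (T_op w - ?e)"
        using norm_bounded[of "T_op w - ?e"] by simp
    qed
    then have "1 \<le> (norm (T_op w - ?e))\<^sup>2"
      by simp
    moreover have "l1_pair w (T_op w - ?e) = t\<^sup>2 - t"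
      by (simp add: l1_pair.diff_right l1_pair_T_op t_def)
        (simp add: l1_pair_def tail_sum_def)
    \<comment> \<open>The lower bound \<open>3 t\<^sup>2 / 2 - t + 1 / 2\<close> has its minimum at \<open>t = 1 / 3\<close>.\<close>
    moreover have "3/2 * t\<^sup>2 - t + 1/2 = 3/2 * (t - 1/3)\<^sup>2 + 1/3"
      by (simp add: power2_eq_square algebra_simps)
    moreover have "0 \<le> 3/2 * (t - 1/3)\<^sup>2" by simp
    ultimately have "1/3 \<le> 1/2 * (norm w)\<^sup>2 + 1/2 * (norm (T_op w - ?e))\<^sup>2 + l1_pair w (T_op w - ?e)"
      by linarith
    then show "ereal (1/3) \<le> (case p of (s, s') \<Rightarrow> ereal (1/2 * (norm (s - 0))\<^sup>2 +
        1/2 * (norm (s' - ?e))\<^sup>2 + l1_pair (s - 0) (s' - ?e)))"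
      by (simp add: p)
  qed
  ultimately have "ereal (1/3) \<le> 0" by (rule order_trans[rotated])
  then show False by simp
qed

section \<open>Quasidensity on the predual\<close>

text \<open>For \<open>r \<ge> 0\<close>, the signed distance of \<open>x\<close> from the interval \<open>[-r, r]\<close>.\<close>

definition soft_threshold :: "real \<Rightarrow> real \<Rightarrow> real"
  where "soft_threshold r x = x - max (- r) (min r x)"

text \<open>A discrete form of the play operator of hysteresis theory. The value \<open>backward_play u N r k\<close>
  is the tail at position \<open>N - k\<close>. If \<open>a\<close> is the tail at \<open>j + 1\<close> and \<open>b\<close> the one at \<open>j\<close>, then
  \<open>(T w + u) j = a + b + u j\<close>; with \<open>b = a\<close> this is \<open>2 a + u j\<close>, and \<open>b\<close> deviates from \<open>a\<close> exactly
  by the amount that brings the value back to the interval \<open>[-r, r]\<close>.\<close>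

primrec backward_play :: "(nat \<Rightarrow> real) \<Rightarrow> nat \<Rightarrow> real \<Rightarrow> nat \<Rightarrow> real"
  where
    "backward_play u N r 0 = 0"
  | "backward_play u N r (Suc k) = backward_play u N r k -
      soft_threshold r (2 * backward_play u N r k + u (N - Suc k))"

lemma continuous_on_backward_play: "continuous_on A (\<lambda>r. backward_play u N r k)"
  by (induction k) (auto simp: soft_threshold_def intro!: continuous_intros)

lemma backward_play_eq_0: "(\<And>j. \<bar>u j\<bar> \<le> M) \<Longrightarrow> backward_play u N M k = 0"
proof (induction k)
  case (Suc k)
  then have "- M \<le> u (N - Suc k)" "u (N - Suc k) \<le> M"
    by (simp_all add: abs_le_iff minus_le_iff)
  with Suc show ?case by (simp add: soft_threshold_def)
qed simp

text \<open>On the first \<open>N\<close> coordinates, \<open>- (T w + u)\<close> belongs to the duality mapping at \<open>w\<close>, and the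
  bound on \<open>r\<close> does not depend on \<open>N\<close>.\<close>

lemma truncated_duality_inclusion:
  fixes u :: "nat \<Rightarrow> real"
  assumes u: "\<And>j. \<bar>u j\<bar> \<le> M"
  obtains w r where "0 \<le> r" "r \<le> M" "norm w = r"
    "\<And>j. j \<ge> N \<Longrightarrow> l1_nth w j = 0" "\<And>j. j \<ge> N \<Longrightarrow> T_op w j = 0"
    "\<And>j. j < N \<Longrightarrow> \<bar>T_op w j + u j\<bar> \<le> r"
    "\<And>j. j < N \<Longrightarrow> l1_nth w j * (T_op w j + u j) = - r * \<bar>l1_nth w j\<bar>"
proof -
  define b where "b r j = backward_play u N r (N - j)" for r j
  define V where "V r = (\<Sum>j<N. \<bar>b r j - b r (Suc j)\<bar>)" for r
  have M: "0 \<le> M" using u[of 0] by linarith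
  have "\<exists>r\<ge>0. r \<le> M \<and> r - V r = 0"
  proof (rule IVT')
    show "0 - V 0 \<le> 0" by (simp add: V_def sum_nonneg)
    show "0 \<le> M - V M" using M by (simp add: V_def b_def backward_play_eq_0[OF u])
    show "continuous_on {0..M} (\<lambda>r. r - V r)"
      unfolding V_def b_def by (intro continuous_intros continuous_on_backward_play)
  qed (rule M)
  then obtain r where r: "0 \<le> r" "r \<le> M" "V r = r" by auto
  define w where "w = l1_trunc N (\<lambda>j. b r j - b r (Suc j))"
  have w_nth: "l1_nth w j = b r j - b r (Suc j)" for j
    by (simp add: w_def b_def)
  have b_end: "b r j = 0" if "j \<ge> N" for j
    using that by (simp add: b_def)
  have "b r \<longlonglongrightarrow> 0"
    by (rule tendsto_eventually) (use b_end in \<open>auto simp: eventually_sequentially\<close>)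
  then have "tail_sum w j = b r j" for j
    by (rule tail_sum_telescope[OF w_nth])
  then have T_w: "T_op w j = b r j + b r (Suc j)" for j
    by (simp add: T_op_apply)
  have step: "b r j = b r (Suc j) - soft_threshold r (2 * b r (Suc j) + u j)" if "j < N" for j
  proof -
    have "N - j = Suc (N - Suc j)" "N - Suc (N - Suc j) = j" using that by auto
    then show ?thesis by (simp add: b_def)
  qed
  show ?thesis
  proof
    show "0 \<le> r" "r \<le> M" by fact+
    show "norm w = r"
    proof -
      have "norm w = (\<Sum>j<N. \<bar>l1_nth w j\<bar>)"
        unfolding norm_l1_eq by (rule suminf_finite) (auto simp: w_nth b_end)
      then show ?thesis using r(3) by (simp add: V_def w_nth)
    qed
    show "l1_nth w j = 0" "T_op w j = 0" if "j \<ge> N" for j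
      using that by (simp_all add: w_nth T_w b_end)
    fix j assume j: "j < N"
    show "\<bar>T_op w j + u j\<bar> \<le> r"
      using step[OF j] r(1) by (simp add: T_w soft_threshold_def max_def min_def split: if_splits)
    \<comment> \<open>With \<open>x = 2 b r (Suc j) + u j\<close>, the value of \<open>T w + u\<close> is \<open>x\<close> clamped to \<open>[-r, r]\<close>, while
      \<open>w j\<close> is minus the excess of \<open>x\<close>: it vanishes or has the sign opposite to the clamped value.\<close>
    define x where "x = 2 * b r (Suc j) + u j"
    have w: "l1_nth w j = - soft_threshold r x" and v: "T_op w j + u j = x - soft_threshold r x"
      using step[OF j] by (simp_all add: w_nth T_w x_def)
    consider "x < - r" | "- r \<le> x" "x \<le> r" | "r < x" by linarith
    then show "l1_nth w j * (T_op w j + u j) = - r * \<bar>l1_nth w j\<bar>"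
      unfolding w v
      by cases (use r(1) in \<open>auto simp: soft_threshold_def max_def min_def algebra_simps\<close>)
  qed
qed

text \<open>The unsolved part of the problem, beyond the first \<open>N\<close> coordinates, only sees the tail of
  \<open>u\<close>, whose contribution \<open>r \<delta> + \<delta>\<^sup>2 / 2\<close> is small because \<open>r \<le> \<parallel>u\<parallel>\<close> independently of \<open>N\<close>.\<close>

lemma approximate_duality_inclusion:
  fixes u :: linf
  assumes u: "apply_bcontfun u \<longlonglongrightarrow> 0" and "e > 0"
  obtains w where
    "1/2 * (norm (T_op w + u))\<^sup>2 + 1/2 * (norm w)\<^sup>2 + l1_pair w (T_op w + u) \<le> e"
proof -
  define M where "M = norm u"
  define \<delta> where "\<delta> = min 1 (e / (M + 1))"
  have M: "0 \<le> M" by (simp add: M_def)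
  have \<delta>: "0 < \<delta>" "\<delta> \<le> 1" using M \<open>e > 0\<close> by (simp_all add: \<delta>_def)
  have "\<delta> * (M + 1) \<le> e / (M + 1) * (M + 1)"
    using M by (intro mult_right_mono) (simp_all add: \<delta>_def)
  then have \<delta>_e: "\<delta> * (M + 1) \<le> e" using M by simp
  from LIMSEQ_D[OF u \<delta>(1)] obtain N where "\<And>j. j \<ge> N \<Longrightarrow> norm (u j - 0) < \<delta>"
    by blast
  then have N: "\<bar>u j\<bar> \<le> \<delta>" if "j \<ge> N" for j
    using that by (simp add: less_imp_le)
  have "\<bar>u j\<bar> \<le> M" for j
    using norm_bounded[of u j] by (simp add: M_def)
  then obtain w r where r: "0 \<le> r" "r \<le> M" "norm w = r"
    and tail: "\<And>j. j \<ge> N \<Longrightarrow> l1_nth w j = 0" "\<And>j. j \<ge> N \<Longrightarrow> T_op w j = 0"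
    and init: "\<And>j. j < N \<Longrightarrow> \<bar>T_op w j + u j\<bar> \<le> r"
      "\<And>j. j < N \<Longrightarrow> l1_nth w j * (T_op w j + u j) = - r * \<bar>l1_nth w j\<bar>"
    by (rule truncated_duality_inclusion[of "apply_bcontfun u" M N]) blast
  have "norm (T_op w + u) \<le> r + \<delta>"
  proof (rule norm_bound)
    fix j
    show "norm ((T_op w + u) j) \<le> r + \<delta>"
      using init(1)[of j] tail(2)[of j] N[of j] r(1) \<delta>(1) by (cases "j < N") auto
  qed
  then have "(norm (T_op w + u))\<^sup>2 \<le> (r + \<delta>)\<^sup>2"
    by (rule power_mono) simp
  moreover have "l1_pair w (T_op w + u) = - r\<^sup>2"
  proof -
    have "l1_nth w j * (T_op w + u) j = - r * \<bar>l1_nth w j\<bar>" for j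
      using init(2)[of j] tail(1)[of j] by (cases "j < N") auto
    then have "l1_pair w (T_op w + u) = - r * norm w"
      by (simp add: l1_pair_def norm_l1_eq suminf_mult[OF summable_l1] suminf_minus
          summable_mult summable_l1)
    then show ?thesis using r(3) by (simp add: power2_eq_square)
  qed
  moreover have "1/2 * (r + \<delta>)\<^sup>2 + 1/2 * r\<^sup>2 - r\<^sup>2 = \<delta> * (r + \<delta> / 2)"
    by (simp add: power2_eq_square algebra_simps)
  moreover have "\<delta> * (r + \<delta> / 2) \<le> \<delta> * (M + 1)"
    using \<delta> r(2) by (intro mult_left_mono) auto
  ultimately have
    "1/2 * (norm (T_op w + u))\<^sup>2 + 1/2 * (norm w)\<^sup>2 + l1_pair w (T_op w + u) \<le> e"
    using \<delta>_e unfolding r(3) by linarith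
  then show ?thesis by (rule that)
qed

text \<open>Writing the points of the graph as \<open>(T (z + w), z + w)\<close> turns the two differences in the
  definition into \<open>T w + u\<close> and \<open>w\<close>, with the null sequence \<open>u = T z - x\<close>.\<close>

lemma quasidense_S_op: "quasidense c0_pair S_op"
  unfolding quasidense_def
proof (intro allI, rule ereal_le_epsilon2)
  fix x :: c0 and z :: l1 and e :: real
  assume "e > 0"
  define u where "u = T_op z - hat x"
  have u: "u = hat (T_c0 z - x)" by (simp add: u_def)
  then obtain w where w:
    "1/2 * (norm (T_op w + u))\<^sup>2 + 1/2 * (norm w)\<^sup>2 + l1_pair w (T_op w + u) \<le> e"
    using approximate_duality_inclusion[OF _ \<open>e > 0\<close>, of u] hat_tendsto by metis
  have shift: "hat (T_c0 (z + w) - x) = T_op w + u"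
    by (simp add: u_def T_op_add)
  show "(INF (s, s')\<in>graph S_op.
      ereal (1/2 * (norm (s - x))\<^sup>2 + 1/2 * (norm (s' - z))\<^sup>2 + c0_pair (s - x) (s' - z))) \<le>
      0 + ereal e"
  proof (rule INF_lower2)
    show "(T_c0 (z + w), z + w) \<in> graph S_op"
      by (simp add: graph_S_op)
    show "(case (T_c0 (z + w), z + w) of (s, s') \<Rightarrow>
        ereal (1/2 * (norm (s - x))\<^sup>2 + 1/2 * (norm (s' - z))\<^sup>2 + c0_pair (s - x) (s' - z))) \<le>
        0 + ereal e"
      using w unfolding shift[symmetric] l1_pair_hat norm_hat by simp
  qed
qed

section \<open>The counterexample\<close>

theorem theorem12p3:
  shows "linear T_op \<and> range T_op \<subseteq> range hat \<and>
    maximally_monotone c0_pair S_op \<and>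
    quasidense c0_pair S_op \<and>
    fitzpatrick_ext c0_pair l1_pair S_op = (\<lambda>y. {T_op y}) \<and>
    maximally_monotone l1_pair (\<lambda>y. {T_op y}) \<and>
    \<not> quasidense l1_pair (\<lambda>y. {T_op y})"
proof (intro conjI)
  show "range T_op \<subseteq> range hat"
    by (metis hat_T_c0 image_subsetI rangeI)
qed (rule linear_T_op maximally_monotone_S_op quasidense_S_op fitzpatrick_ext_S_op
    maximally_monotone_T_op not_quasidense_T_op)+

end
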